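(* Let $\mathcal{D}=\mathcal{A}\cup\mathcal{N}$ be a finite dataset in $\mathbb{R}^d$ with anomalous points $\mathcal{A}$ and normal points $\mathcal{N}$, and let $\mathcal{E}$ be a finite set of packs. Let $R'_\ell$ be the cardinality-constrained description-length-reduction objective on subsets $\mathcal{S}\subseteq\mathcal{E}$, $$R'_\ell(\mathcal{S}) = \Big|\bigcup_{p\in\mathcal{S}}\mathcal{A}_p\Big|\, c_u - \sum_{p\in\mathcal{S}}L(p) + \Big[\log^\star|\mathcal{E}| + \sum_{p'\in\mathcal{E}}L(p')\Big].$$ Then $R'_\ell$ is submodular: for all subsets $\mathcal{S}\subseteq\mathcal{T}\subseteq\mathcal{E}$ and all packs $p\in\mathcal{E}\setminus\mathcal{T}$, $$R'_\ell(\mathcal{S}\cup\{p\})-R'_\ell(\mathcal{S})\;\ge\;R'_\ell(\mathcal{T}\cup\{p\})-R'_\ell(\mathcal{T}).$$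
   Context: Dataset: $\mathcal{D}\subset\mathbb{R}^{d}$ has $m$ points, partitioned into labeled anomalous points $\mathcal{A}$ and normal points $\mathcal{N}$; the feature set is $\mathcal{F}$ with $|\mathcal{F}|=d$. Pack: a pack $p$ is a hyper-ellipsoid in a feature subspace $\mathcal{F}_p\subseteq\mathcal{F}$ with $|\mathcal{F}_p|=d_p$, given by a center $\mathbf{c}\in\mathbb{R}^{d_p}$ and a positive definite matrix $\mathbf{M}\in\mathbb{R}^{d_p\times d_p}$: $p=\{\mathbf{x} : (\mathbf{x}-\mathbf{c})^T\mathbf{M}^{-1}(\mathbf{x}-\mathbf{c})\le 1\}$ (a data point lies in the pack if its projection to the features $\mathcal{F}_p$ does). $\mathcal{A}_p\subseteq\mathcal{A}$ and $\mathcal{N}_p\subseteq\mathcal{N}$ are the anomalous and normal points enclosed by $p$; $n_p=|\mathcal{N}_p|$ and $m_p=|\mathcal{A}_p|+|\mathcal{N}_p|$. Costs: $f$ is a fixed constant determined by the floating point precision (so $\log_2 f>0$ bits encode one real number), and $c_u=d\log_2 f$ is the cost of encoding a single point. $\log^\star(K)=\log_2 K+\log_2\log_2 K+\cdots$, summing only the positive terms (so it is $0$ when there are none). The encoding cost of a pack $p$ is $$L(p)=\log^\star d_p+\log_2\binom{d}{d_p}+d_p(d_p+1)\log_2 f+\log^\star n_p+\log_2\binom{m_p}{n_p}.$$ The full objective is $R_\ell(\mathcal{S})=|\bigcup_{p\in\mathcal{S}}\mathcal{A}_p|c_u-\log^\star|\mathcal{S}|-\sum_{p\in\mathcal{S}}L(p)+[\log^\star|\mathcal{E}|+\sum_{p'\in\mathcal{E}}L(p')]$.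 The modified (cardinality-constrained) objective $R'_\ell$ is obtained by treating the size $|\mathcal{S}|=K$ as fixed, so that the term $\log^\star|\mathcal{S}|$ is a constant and is dropped, i.e. $R_\ell(\mathcal{S})=R'_\ell(\mathcal{S})-\log^\star K$. *)

theory Defs
  imports
    Complex_Main
    "Jordan_Normal_Form.Gauss_Jordan_Elimination"
    "Jordan_Normal_Form.Determinant"
    "Jordan_Normal_Form.DL_Missing_Sublist"
begin

text \<open>
  The sum of the positive terms of \<open>log\<^sub>2 x, log\<^sub>2 (log\<^sub>2 x), \<dots>\<close>.  The test \<open>x > 1\<close> says that the next
  term \<open>log\<^sub>2 x\<close> is positive; the sum stops at the first term that is not, since the logarithm of
  such a term is undefined.  In particular \<open>log_star 0 = log_star 1 = 0\<close>.
\<close>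

function log_star :: "real \<Rightarrow> real" where
  "log_star x = (if x > 1 then log 2 x + log_star (log 2 x) else 0)"
  by auto

lemma log2_le_nat_minus_one:
  fixes x :: real and n :: nat
  assumes "1 < x" "x \<le> real n"
  shows "log 2 x \<le> real (n - 1)"
proof -
  have n: "1 < real n" using assms by linarith
  have "n - 1 < 2 ^ (n - 1)" by (rule less_exp)
  hence "n \<le> 2 ^ (n - 1)" by linarith
  hence "real n \<le> 2 ^ (n - 1)" by (metis of_nat_le_iff of_nat_numeral of_nat_power)
  hence "x \<le> 2 ^ (n - 1)" using assms(2) by linarith
  hence "x \<le> 2 powr real (n - 1)" by (simp only: powr_realpow zero_less_numeral)
  thus ?thesis using assms(1) by (simp add: log_le_iff)
qed

termination log_star
proof (relation "measure (\<lambda>x. nat \<lceil>x\<rceil>)")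
  fix x :: real
  assume x: "1 < x"
  have "log 2 x \<le> real (nat \<lceil>x\<rceil> - 1)"
    by (rule log2_le_nat_minus_one[OF x]) (rule real_nat_ceiling_ge)
  hence "nat \<lceil>log 2 x\<rceil> \<le> nat \<lceil>x\<rceil> - 1" 
    by (metis ceiling_le_iff nat_le_iff of_int_of_nat_eq)
  moreover have "0 < nat \<lceil>x\<rceil>" using x by simp
  ultimately have "nat \<lceil>log 2 x\<rceil> < nat \<lceil>x\<rceil>" by linarith
  thus "(log 2 x, x) \<in> measure (\<lambda>x. nat \<lceil>x\<rceil>)" by (simp only: in_measure)
qed simp

declare log_star.simps [simp del]

text \<open>
  The feature set is \<open>{0..<d}\<close>, and data points are vectors in \<open>carrier_vec d\<close>.
\<close>

record pack =
  features :: "nat set"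
  center :: "real vec"
  shape :: "real mat"

abbreviation pack_dim :: "pack \<Rightarrow> nat" where
  "pack_dim p \<equiv> card (features p)"

definition pos_def_mat :: "nat \<Rightarrow> real mat \<Rightarrow> bool" where
  "pos_def_mat n M \<longleftrightarrow>
     M \<in> carrier_mat n n \<and> transpose_mat M = M \<and>
     (\<forall>v \<in> carrier_vec n. v \<noteq> 0\<^sub>v n \<longrightarrow> v \<bullet> (M *\<^sub>v v) > 0)"

definition is_pack :: "nat \<Rightarrow> pack \<Rightarrow> bool" where
  "is_pack d p \<longleftrightarrow>
     features p \<subseteq> {0..<d} \<and>
     center p \<in> carrier_vec (pack_dim p) \<and>
     pos_def_mat (pack_dim p) (shape p)"

text \<open>\<open>mat_inverse\<close> never returns \<open>None\<close> on the shape matrix of a pack.\<close>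

lemma pos_def_mat_inverse:
  assumes "pos_def_mat n M"
  obtains B where "mat_inverse M = Some B" "B \<in> carrier_mat n n"
    "M * B = 1\<^sub>m n" "B * M = 1\<^sub>m n"
proof -
  have M: "M \<in> carrier_mat n n" using assms by (simp add: pos_def_mat_def)
  have "det M \<noteq> 0"
  proof
    assume "det M = 0"
    then obtain v where v: "v \<in> carrier_vec n" "v \<noteq> 0\<^sub>v n" "M *\<^sub>v v = 0\<^sub>v n"
      using det_0_iff_vec_prod_zero_field[OF M] by blast
    hence "v \<bullet> (M *\<^sub>v v) = 0" by simp
    thus False using assms v(1,2) by (force simp: pos_def_mat_def)
  qed
  hence "M \<in> Units (ring_mat TYPE(real) n ())"
    by (rule det_non_zero_imp_unit[OF M])
  hence "mat_inverse M \<noteq> None" using mat_inverse(1)[OF M, of "()"] by blast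
  then obtain B where "mat_inverse M = Some B" by blast
  thus thesis using that mat_inverse(2)[OF M] by blast
qed

definition ellipsoid :: "pack \<Rightarrow> real vec set" where
  "ellipsoid p = {x \<in> carrier_vec (pack_dim p).
     (x - center p) \<bullet> (the (mat_inverse (shape p)) *\<^sub>v (x - center p)) \<le> 1}"

text \<open>\<open>pick F i\<close> is the \<open>i\<close>-th smallest element of \<open>F\<close>, counting from zero.\<close>

definition proj_features :: "nat set \<Rightarrow> real vec \<Rightarrow> real vec" where
  "proj_features F x = vec (card F) (\<lambda>i. x $ pick F i)"

definition enclosed :: "real vec set \<Rightarrow> pack \<Rightarrow> real vec set" where
  "enclosed X p = {x \<in> X. proj_features (features p) x \<in> ellipsoid p}"

text \<open>
  In the following, \<open>A\<close> and \<open>N\<close> are the anomalous and the normal points, \<open>log 2 f\<close> is the number of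
  bits for one real number.  The term \<open>d\<^sub>p (d\<^sub>p + 1)\<close> counts the \<open>d\<^sub>p\<close> entries of the center and the
  \<open>d\<^sub>p\<^sup>2\<close> entries of the matrix.
\<close>

definition pack_cost ::
  "nat \<Rightarrow> real \<Rightarrow> real vec set \<Rightarrow> real vec set \<Rightarrow> pack \<Rightarrow> real" where
  "pack_cost d f A N p =
     (let dp = pack_dim p;
          np = card (enclosed N p);
          mp = card (enclosed A p) + card (enclosed N p)
      in log_star (real dp) + log 2 (real (d choose dp))
         + real dp * (real dp + 1) * log 2 f
         + log_star (real np) + log 2 (real (mp choose np)))"

definition point_cost :: "nat \<Rightarrow> real \<Rightarrow> real" where
  "point_cost d f = real d * log 2 f"

definition card_constrained_reduction ::
  "nat \<Rightarrow> real \<Rightarrow> real vec set \<Rightarrow> real vec set \<Rightarrow> pack set \<Rightarrow> pack set \<Rightarrow> real" where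
  "card_constrained_reduction d f A N E S =
     real (card (\<Union>p\<in>S. enclosed A p)) * point_cost d f
     - (\<Sum>p\<in>S. pack_cost d f A N p)
     + (log_star (real (card E)) + (\<Sum>p\<in>E. pack_cost d f A N p))"

definition submodular_on :: "'a set \<Rightarrow> ('a set \<Rightarrow> real) \<Rightarrow> bool" where
  "submodular_on E R \<longleftrightarrow>
     (\<forall>S T p. S \<subseteq> T \<longrightarrow> T \<subseteq> E \<longrightarrow> p \<in> E - T \<longrightarrow>
        R (S \<union> {p}) - R S \<ge> R (T \<union> {p}) - R T)"

end

theory Submission
  imports Defs
begin

text \<open>The objective is a weighted coverage function minus a modular cost plus a constant.
  Adding a new pack \<open>p\<close> to \<open>S\<close> gains \<open>point_cost d f\<close> for
  each anomaly of \<open>p\<close> that \<open>S\<close> leaves uncovered, and costs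
  \<open>pack_cost d f A N p\<close>, which does not depend on \<open>S\<close>
  (\<open>card_constrained_reduction_gain\<close>). A larger \<open>S\<close> leaves fewer anomalies
  of \<open>p\<close> uncovered, so the gain can only shrink.\<close>

lemma card_Un_diff:
  assumes "finite U" and "finite B"
  shows "real (card (U \<union> B)) - real (card U) = real (card (B - U))"
proof -
  have "card (U \<union> B) = card U + card (B - U)"
    using card_Un_disjoint[of U "B - U"] assms by auto
  then show ?thesis by simp
qed

lemma finite_enclosed: "finite X \<Longrightarrow> finite (enclosed X p)"
  by (simp add: enclosed_def)

text \<open>The bracket over \<open>E\<close> cancels in the difference, and since
  \<open>p \<notin> S\<close> the cost sum grows by exactly one term. Only the coverage change
  depends on \<open>S\<close>.\<close>

lemma card_constrained_reduction_gain:
  assumes "finite A" and "finite S" and "p \<notin> S"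
  shows "card_constrained_reduction d f A N E (S \<union> {p}) - card_constrained_reduction d f A N E S
    = real (card (enclosed A p - (\<Union>q\<in>S. enclosed A q))) * point_cost d f
      - pack_cost d f A N p"
proof -
  let ?U = "\<Union>q\<in>S. enclosed A q"
  have "finite ?U"
    using assms by (simp add: finite_enclosed)
  then have "real (card (?U \<union> enclosed A p)) = real (card ?U) + real (card (enclosed A p - ?U))"
    using card_Un_diff[of ?U "enclosed A p"] finite_enclosed[OF assms(1)] by simp
  moreover have "(\<Union>q\<in>S \<union> {p}. enclosed A q) = ?U \<union> enclosed A p"
    by auto
  ultimately show ?thesis
    using assms(2,3) by (simp add: card_constrained_reduction_def algebra_simps)
qed

theorem theorem1:
  fixes d :: nat and f :: real
    and A N :: "real vec set"
    and E :: "pack set"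
  assumes "finite A" and "A \<subseteq> carrier_vec d"
    and "finite N" and "N \<subseteq> carrier_vec d"
    and "A \<inter> N = {}"
    and "f > 0" and "log 2 f > 0"
    and "finite E" and "\<forall>p\<in>E. is_pack d p"
  shows "submodular_on E (card_constrained_reduction d f A N E)"
  unfolding submodular_on_def
proof (intro allI impI)
  fix S T p
  assume ST: "S \<subseteq> T" and TE: "T \<subseteq> E" and p: "p \<in> E - T"
  have fin: "finite S" "finite T"
    using ST TE \<open>finite E\<close> by (auto intro: finite_subset)
  have "card (enclosed A p - (\<Union>q\<in>T. enclosed A q)) \<le> card (enclosed A p - (\<Union>q\<in>S. enclosed A q))"
    using ST \<open>finite A\<close> by (intro card_mono) (auto simp: finite_enclosed)
  \<comment> \<open>The sign of the weight lets the cardinality inequality survive scaling; the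
    weight is zero when \<open>d = 0\<close>.\<close>
  moreover have "point_cost d f \<ge> 0"
    using \<open>log 2 f > 0\<close> by (simp add: point_cost_def)
  ultimately have "real (card (enclosed A p - (\<Union>q\<in>T. enclosed A q))) * point_cost d f
    \<le> real (card (enclosed A p - (\<Union>q\<in>S. enclosed A q))) * point_cost d f"
    by (intro mult_right_mono) simp_all
  \<comment> \<open>\<open>p\<close> is new to both sets, so the gain formula applies to each and
    the same cost of \<open>p\<close> is subtracted on both sides.\<close>
  moreover have "p \<notin> S" "p \<notin> T"
    using ST p by auto
  ultimately show "card_constrained_reduction d f A N E (S \<union> {p}) - card_constrained_reduction d f A N E S
    \<ge> card_constrained_reduction d f A N E (T \<union> {p}) - card_constrained_reduction d f A N E T"
    using card_constrained_reduction_gain[OF \<open>finite A\<close>] fin by simp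
qed

end
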